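(* Let $G\colon \mathbb{M}^{\circ}\to \mathrm{vect}_K$ be a sequentially continuous (pointwise finite-dimensional) cohomological functor. Then $$G\;\cong\;\bigoplus_{v\in \operatorname{int}\mathbb{M}} (B_v)^{\oplus \nu(v)},\qquad \text{where } \nu:=\operatorname{Dgm}(G).$$
   Context: Fix reals $c_0<c_1$ and the lines $l_i=\{(x,y)\in\mathbb{R}^2: x+y=c_i\}$, $i=0,1$. The strip $\mathbb{M}=\{(x,y)\in\mathbb{R}^2: c_0\le x+y\le c_1\}$ is a poset (and thin category) with $(x,y)\preceq(x',y')$ iff $x\ge x'$ and $y\le y'$. It has the Euclidean topology, $\partial\mathbb{M}=l_0\cup l_1$, $\operatorname{int}\mathbb{M}=\mathbb{M}\setminus\partial\mathbb{M}$; $\uparrow u$ and $\downarrow u$ denote the upset and downset of $u$ in $\mathbb{M}$. Let $T\colon\mathbb{M}\to\mathbb{M}$, $T(x,y)=(c_0-y,\,c_1-x)$, a poset automorphism. $K$ is a field, $\mathrm{Vect}_K$ ($\mathrm{vect}_K$) is the category of (finite-dimensional) $K$-vector spaces. A functor $F\colon\mathbb{M}^\circ\to\mathrm{Vect}_K$ is a contravariant functor on $\mathbb{M}$; for $u\preceq v$ it has an internal map $F(u\preceq v)\colon F(v)\to F(u)$. Cohomological: $F\colon\mathbb{M}^\circ\to\mathrm{Vect}_K$ is cohomological if $F$ vanishes on $\partial\mathbb{M}$ and for any axis-aligned rectangle contained in $\mathbb{M}$ with corners $w=(x',y')$, $v=(x',y)$, $u=(x,y)$ and $(x,y')$, where $x'\le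 x$, $y\le y'$ and $(x,y')\in l_1$ (so $u\preceq v\preceq w\preceq T(u)$), the long sequence of internal maps $$\cdots\to F(T(u))\to F(w)\to F(v)\to F(u)\to F(T^{-1}(w))\to\cdots$$ is exact. Sequentially continuous: for any increasing sequence $(u_k)_{k\ge1}$ in $\mathbb{M}$ (i.e. $u_k\preceq u_{k+1}$) converging to $u\in\mathbb{M}$, the natural map $F(u)\to\varprojlim_k F(u_k)$ is an isomorphism. Persistence diagram: $\operatorname{Dgm}(F)\colon\operatorname{int}\mathbb{M}\to\mathbb{N}_0$, $u\mapsto \dim_K F(u)-\dim_K\sum_{v\succ u}\operatorname{Im}F(u\preceq v)$, with $v$ ranging over all $v\in\mathbb{M}$, $v\succ u$. Contravariant block: for $v\in\mathbb{M}$, $B_v\colon\mathbb{M}^\circ\to\mathrm{Vect}_K$ has $B_v(u)=K$ if $u\in(\downarrow v)\cap\operatorname{int}(\uparrow T^{-1}(v))$ (interior taken in $\mathbb{M}$) and $B_v(u)=0$ otherwise; internal maps are identities when domain and codomain are both $K$, and zero otherwise. *)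

theory Defs
  imports "HOL-Analysis.Analysis" "HOL-Library.Poly_Mapping"
begin

definition strip :: "real \<Rightarrow> real \<Rightarrow> (real \<times> real) set" where
  "strip c0 c1 = {(x, y). c0 \<le> x + y \<and> x + y \<le> c1}"

definition strip_line :: "real \<Rightarrow> (real \<times> real) set" where
  "strip_line c = {(x, y). x + y = c}"

definition strip_boundary :: "real \<Rightarrow> real \<Rightarrow> (real \<times> real) set" where
  "strip_boundary c0 c1 = strip_line c0 \<union> strip_line c1"

definition strip_interior :: "real \<Rightarrow> real \<Rightarrow> (real \<times> real) set" where
  "strip_interior c0 c1 = strip c0 c1 - strip_boundary c0 c1"

text \<open>The order is reversed in the first coordinate, so it is not the product order.\<close>

definition strip_le :: "real \<times> real \<Rightarrow> real \<times> real \<Rightarrow> bool" (infix "\<preceq>" 50) where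
  "u \<preceq> v \<longleftrightarrow> fst v \<le> fst u \<and> snd u \<le> snd v"

definition strip_less :: "real \<times> real \<Rightarrow> real \<times> real \<Rightarrow> bool" (infix "\<prec>" 50) where
  "u \<prec> v \<longleftrightarrow> u \<preceq> v \<and> u \<noteq> v"

definition strip_up :: "real \<Rightarrow> real \<Rightarrow> real \<times> real \<Rightarrow> (real \<times> real) set" where
  "strip_up c0 c1 u = {w \<in> strip c0 c1. u \<preceq> w}"

definition strip_down :: "real \<Rightarrow> real \<Rightarrow> real \<times> real \<Rightarrow> (real \<times> real) set" where
  "strip_down c0 c1 u = {w \<in> strip c0 c1. w \<preceq> u}"

text \<open>The automorphism \<open>T\<close> of the strip is given by the same formula on the whole plane, where it is
  a bijection that preserves the strip; hence \<open>inv\<close> yields its inverse on the strip.\<close>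

definition strip_T :: "real \<Rightarrow> real \<Rightarrow> real \<times> real \<Rightarrow> real \<times> real" where
  "strip_T c0 c1 = (\<lambda>(x, y). (c0 - y, c1 - x))"

lemma inv_strip_T: "inv (strip_T c0 c1) = (\<lambda>(x, y). (c1 - y, c0 - x))"
  by (rule inv_unique_comp) (auto simp: strip_T_def fun_eq_iff)

lemma bij_betw_strip_T: "bij_betw (strip_T c0 c1) (strip c0 c1) (strip c0 c1)"
  by (rule bij_betw_byWitness[where f' = "\<lambda>(x, y). (c1 - y, c0 - x)"])
    (auto simp: strip_T_def strip_def)

definition strip_T_iter :: "real \<Rightarrow> real \<Rightarrow> int \<Rightarrow> real \<times> real \<Rightarrow> real \<times> real" where
  "strip_T_iter c0 c1 n =
     (if 0 \<le> n then strip_T c0 c1 ^^ nat n else inv (strip_T c0 c1) ^^ nat (- n))"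


text \<open>
  A family of \<open>K\<close>-vector spaces indexed by the points of the strip is represented by subspaces
  \<open>obj F u\<close> of one ambient vector space \<open>('v, scalar_mult F)\<close>. This is no restriction: an arbitrary family of
  vector spaces embeds into its direct sum. The map \<open>imap F u v\<close> is the internal map
  \<open>F(u \<preceq> v) : F(v) \<rightarrow> F(u)\<close>; its values matter only for \<open>u \<preceq> v\<close> in the strip and on \<open>obj F v\<close>.
\<close>

record ('k, 'v) presheaf =
  scalar_mult :: "'k \<Rightarrow> 'v \<Rightarrow> 'v"
  obj :: "real \<times> real \<Rightarrow> 'v set"
  imap :: "real \<times> real \<Rightarrow> real \<times> real \<Rightarrow> 'v \<Rightarrow> 'v"

definition linear_between ::
  "('k \<Rightarrow> 'v::ab_group_add \<Rightarrow> 'v) \<Rightarrow> 'v set \<Rightarrow> ('k \<Rightarrow> 'w::ab_group_add \<Rightarrow> 'w) \<Rightarrow> 'w set \<Rightarrow> ('v \<Rightarrow> 'w) \<Rightarrow> bool"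
  where
  "linear_between s V t W f \<longleftrightarrow>
     f ` V \<subseteq> W \<and>
     (\<forall>x\<in>V. \<forall>y\<in>V. f (x + y) = f x + f y) \<and>
     (\<forall>c. \<forall>x\<in>V. f (s c x) = t c (f x))"

definition contravariant_functor ::
  "real \<Rightarrow> real \<Rightarrow> ('k::field, 'v::ab_group_add) presheaf \<Rightarrow> bool" where
  "contravariant_functor c0 c1 F \<longleftrightarrow>
     vector_space (scalar_mult F) \<and>
     (\<forall>u\<in>strip c0 c1. module.subspace (scalar_mult F) (obj F u)) \<and>
     (\<forall>u\<in>strip c0 c1. \<forall>v\<in>strip c0 c1. u \<preceq> v \<longrightarrow>
        linear_between (scalar_mult F) (obj F v) (scalar_mult F) (obj F u) (imap F u v)) \<and>
     (\<forall>u\<in>strip c0 c1. \<forall>x\<in>obj F u. imap F u u x = x) \<and>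
     (\<forall>u\<in>strip c0 c1. \<forall>v\<in>strip c0 c1. \<forall>w\<in>strip c0 c1. u \<preceq> v \<longrightarrow> v \<preceq> w \<longrightarrow>
        (\<forall>x\<in>obj F w. imap F u w x = imap F u v (imap F v w x)))"

definition pointwise_finite_dimensional ::
  "real \<Rightarrow> real \<Rightarrow> ('k::field, 'v::ab_group_add) presheaf \<Rightarrow> bool" where
  "pointwise_finite_dimensional c0 c1 F \<longleftrightarrow>
     (\<forall>u\<in>strip c0 c1. \<exists>B. finite B \<and> module.span (scalar_mult F) B = obj F u)"

text \<open>Exactness of \<open>F(c) \<rightarrow> F(b) \<rightarrow> F(a)\<close> at \<open>F(b)\<close>, for \<open>a \<preceq> b \<preceq> c\<close>.\<close>

definition exact_at ::
  "('k, 'v::ab_group_add) presheaf \<Rightarrow> real \<times> real \<Rightarrow> real \<times> real \<Rightarrow> real \<times> real \<Rightarrow> bool" where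
  "exact_at F a b c \<longleftrightarrow> imap F b c ` obj F c = {x \<in> obj F b. imap F a b x = 0}"

text \<open>The long sequence consists of the values of \<open>F\<close> at
  \<open>\<dots> \<preceq> T\<^sup>n\<^sup>-\<^sup>1(w) \<preceq> T\<^sup>n(u) \<preceq> T\<^sup>n(v) \<preceq> T\<^sup>n(w) \<preceq> T\<^sup>n\<^sup>+\<^sup>1(u) \<preceq> \<dots>\<close> for all integers \<open>n\<close>.\<close>

definition cohomological ::
  "real \<Rightarrow> real \<Rightarrow> ('k::field, 'v::ab_group_add) presheaf \<Rightarrow> bool" where
  "cohomological c0 c1 F \<longleftrightarrow>
     (\<forall>u\<in>strip_boundary c0 c1. obj F u = {0}) \<and>
     (\<forall>x x' y y'. x' \<le> x \<longrightarrow> y \<le> y' \<longrightarrow> {x'..x} \<times> {y..y'} \<subseteq> strip c0 c1 \<longrightarrow>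
        (x, y') \<in> strip_line c1 \<longrightarrow>
        (let u = (x, y); v = (x', y); w = (x', y'); T = strip_T_iter c0 c1 in
         \<forall>n. exact_at F (T (n - 1) w) (T n u) (T n v) \<and>
             exact_at F (T n u) (T n v) (T n w) \<and>
             exact_at F (T n v) (T n w) (T (n + 1) u)))"

definition inverse_limit ::
  "('k, 'v) presheaf \<Rightarrow> (nat \<Rightarrow> real \<times> real) \<Rightarrow> (nat \<Rightarrow> 'v) set" where
  "inverse_limit F U =
     {s. (\<forall>k. s k \<in> obj F (U k)) \<and> (\<forall>j k. j \<le> k \<longrightarrow> imap F (U j) (U k) (s k) = s j)}"

text \<open>The natural map is linear for every functor, so being an isomorphism amounts to bijectivity.\<close>

definition sequentially_continuous ::
  "real \<Rightarrow> real \<Rightarrow> ('k, 'v) presheaf \<Rightarrow> bool" where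
  "sequentially_continuous c0 c1 F \<longleftrightarrow>
     (\<forall>U. \<forall>u\<in>strip c0 c1.
        (\<forall>k. U k \<in> strip c0 c1) \<longrightarrow> (\<forall>k. U k \<preceq> U (Suc k)) \<longrightarrow> U \<longlonglongrightarrow> u \<longrightarrow>
        bij_betw (\<lambda>x k. imap F (U k) u x) (obj F u) (inverse_limit F U))"

text \<open>The sum of a family of subspaces is the span of its union. For pointwise finite-dimensional
  \<open>F\<close> it is a subspace of the finite-dimensional space \<open>obj F u\<close>, so the subtraction in \<open>nat\<close> does
  not truncate and \<open>dim\<close> (which is 0 on infinite-dimensional spaces) is the true dimension.\<close>

definition Dgm ::
  "real \<Rightarrow> real \<Rightarrow> ('k::field, 'v::ab_group_add) presheaf \<Rightarrow> real \<times> real \<Rightarrow> nat" where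
  "Dgm c0 c1 F u =
     vector_space.dim (scalar_mult F) (obj F u) -
     vector_space.dim (scalar_mult F)
       (module.span (scalar_mult F) (\<Union>v\<in>{v \<in> strip c0 c1. u \<prec> v}. imap F u v ` obj F v))"

definition block_support :: "real \<Rightarrow> real \<Rightarrow> real \<times> real \<Rightarrow> (real \<times> real) set" where
  "block_support c0 c1 v =
     strip_down c0 c1 v \<inter>
     (top_of_set (strip c0 c1) interior_of strip_up c0 c1 (inv (strip_T c0 c1) v))"

definition block :: "real \<Rightarrow> real \<Rightarrow> real \<times> real \<Rightarrow> ('k::field, 'k) presheaf" where
  "block c0 c1 v =
     \<lparr> scalar_mult = (*),
       obj = (\<lambda>u. if u \<in> block_support c0 c1 v then UNIV else {0}),
       imap = (\<lambda>u w x. if u \<in> block_support c0 c1 v \<and> w \<in> block_support c0 c1 v then x else 0) \<rparr>"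

text \<open>Pointwise direct sum; its elements are the finitely supported families.
  Note that \<open>Poly_Mapping.mapp\<close> applies a function to the nonzero components only, which is harmless
  here as scalar multiplications and internal maps send 0 to 0.\<close>

definition direct_sum ::
  "'i set \<Rightarrow> ('i \<Rightarrow> ('k, 'v::zero) presheaf) \<Rightarrow> ('k, 'i \<Rightarrow>\<^sub>0 'v) presheaf" where
  "direct_sum I F =
     \<lparr> scalar_mult = (\<lambda>c. Poly_Mapping.mapp (\<lambda>i. scalar_mult (F i) c)),
       obj = (\<lambda>u. {p. Poly_Mapping.keys p \<subseteq> I \<and> (\<forall>i\<in>I. Poly_Mapping.lookup p i \<in> obj (F i) u)}),
       imap = (\<lambda>u v. Poly_Mapping.mapp (\<lambda>i. imap (F i) u v)) \<rparr>"

definition direct_power :: "('k, 'v::zero) presheaf \<Rightarrow> nat \<Rightarrow> ('k, nat \<Rightarrow>\<^sub>0 'v) presheaf" where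
  "direct_power F n = direct_sum {..<n} (\<lambda>_. F)"

definition naturally_isomorphic ::
  "real \<Rightarrow> real \<Rightarrow> ('k, 'v::ab_group_add) presheaf \<Rightarrow> ('k, 'w::ab_group_add) presheaf \<Rightarrow> bool" where
  "naturally_isomorphic c0 c1 F G \<longleftrightarrow>
     (\<exists>\<eta>. (\<forall>u\<in>strip c0 c1.
             linear_between (scalar_mult F) (obj F u) (scalar_mult G) (obj G u) (\<eta> u) \<and>
             bij_betw (\<eta> u) (obj F u) (obj G u)) \<and>
          (\<forall>u\<in>strip c0 c1. \<forall>v\<in>strip c0 c1. u \<preceq> v \<longrightarrow>
             (\<forall>x\<in>obj F v. \<eta> u (imap F u v x) = imap G u v (\<eta> v x))))"

end

theory Submission
  imports Defs
begin

text \<open>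
  Maps out of a block are as simple as maps out of a representable functor: \<open>B\<^sub>v\<close> is the
  representable functor at \<open>v\<close> with its values below the boundary points of the downset of \<open>v\<close>
  made zero, and \<open>G\<close> vanishes on the boundary. So a vector of \<open>G(v)\<close> is the same as a map
  \<open>B\<^sub>v \<rightarrow> G\<close>. Write \<open>rad v\<close> for the sum of the images in \<open>G(v)\<close> of all \<open>G(w)\<close> with \<open>v \<prec> w\<close>. A
  basis of a complement of \<open>rad v\<close> in \<open>G(v)\<close> has \<open>Dgm(G)(v)\<close> elements, and these bases together
  define a natural map \<open>\<Phi>\<close> from the sum of blocks to \<open>G\<close>. The proof shows that \<open>\<Phi>\<close> is bijective
  at every \<open>u\<close>.

  Two places of the long exact sequence suffice: the image of a vertical map with codomain
  \<open>G(u)\<close> is the kernel of a horizontal map out of \<open>G(u)\<close>, and the image of a horizontal map is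
  the kernel of a vertical one. Together they describe the image in \<open>G(u)\<close> of \<open>G(a, b)\<close>, for
  \<open>(a, b)\<close> between \<open>u\<close> and \<open>T(u)\<close>, as the intersection of two kernels, of which one depends only
  on \<open>a\<close> and the other only on \<open>b\<close> (\<open>image_iff_kernels\<close>). This has two consequences. The images
  of \<open>G(a, b)\<close> and \<open>G(a', b')\<close> intersect in the image of the join of both points. And since
  sequential continuity makes kernels compatible with limits, a vector that comes from each point
  of an increasing sequence also comes from its limit.

  Injectivity: in a relation between the images of generators, take the generator whose point
  has the largest first coordinate and, among those, the smallest second coordinate. By the
  intersection property its image comes from strictly above, and the kernel of \<open>G(v) \<rightarrow> G(u)\<close>
  lies in \<open>rad v\<close> for \<open>u\<close> in the support of \<open>B\<^sub>v\<close> (\<open>kernel_subset_rad\<close>). So the combination of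
  generators at this point lies in \<open>rad v\<close>, and it is trivial.

  Surjectivity: otherwise choose, among the images in \<open>G(u)\<close> that are not generated, one of
  smallest dimension. By the closedness under limits it is the image of some \<open>G(v)\<close> with \<open>v\<close>
  highest possible (\<open>largest_zero_attained\<close>). All points above \<open>v\<close> have smaller, hence generated
  images. But \<open>G(v)\<close> is spanned by \<open>rad v\<close> and the generators at \<open>v\<close>.
\<close>

section \<open>Linear algebra\<close>

lemma (in vector_space) complement_basis:
  assumes S: "subspace S" and V: "subspace V" and "S \<subseteq> V"
    and fin: "finite F" "V \<subseteq> span F"
  obtains C where "finite C" "C \<subseteq> V" "dim V = dim S + card C"
    "\<forall>z\<in>V. \<exists>s\<in>S. \<exists>f. z = s + (\<Sum>x\<in>C. scale (f x) x)"
    "\<forall>f. (\<Sum>x\<in>C. scale (f x) x) \<in> S \<longrightarrow> (\<forall>x\<in>C. f x = 0)"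
proof -
  obtain B where B: "B \<subseteq> S" "independent B" "S \<subseteq> span B" "card B = dim S"
    using basis_exists by blast
  obtain B' where B': "B \<subseteq> B'" "B' \<subseteq> V" "independent B'" "V \<subseteq> span B'"
    using maximal_independent_subset_extend[OF order_trans[OF B(1) \<open>S \<subseteq> V\<close>] B(2)] by metis
  have finB': "finite B'"
    using independent_span_bound[OF fin(1) B'(3)] B'(2) fin(2) by blast
  have finB: "finite B" using finB' B'(1) finite_subset by blast
  have "card B' = dim V"
    using basis_card_eq_dim B' by blast
  then have dimV: "dim V = dim S + card (B' - B)"
    using B(4) B'(1) finB finB' by (metis add_diff_inverse_nat card_Diff_subset card_mono not_less)
  have sp: "\<exists>s\<in>S. \<exists>f. z = s + (\<Sum>x\<in>B' - B. scale (f x) x)" if "z \<in> V" for z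
  proof -
    have "z \<in> range (\<lambda>f. \<Sum>x\<in>B'. scale (f x) x)"
      using subsetD[OF B'(4) that] by (simp only: span_finite[OF finB'])
    then obtain f where f: "z = (\<Sum>x\<in>B'. scale (f x) x)" by (rule rangeE)
    have "(\<Sum>x\<in>B. scale (f x) x) \<in> S"
      using B(1) S by (intro subspace_sum subspace_scale) auto
    moreover have "z = (\<Sum>x\<in>B. scale (f x) x) + (\<Sum>x\<in>B' - B. scale (f x) x)"
      unfolding f by (subst sum.subset_diff[OF B'(1) finB']) (simp add: add.commute)
    ultimately show ?thesis by blast
  qed
  have indep: "\<forall>x\<in>B' - B. f x = 0" if f: "(\<Sum>x\<in>B' - B. scale (f x) x) \<in> S" for f
  proof -
    obtain g where g: "(\<Sum>x\<in>B' - B. scale (f x) x) = (\<Sum>x\<in>B. scale (g x) x)"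
      using f B(3) span_finite[OF finB] by auto
    have "(\<Sum>x\<in>B'. scale (if x \<in> B then - g x else f x) x)
        = (\<Sum>x\<in>B' - B. scale (f x) x) + (\<Sum>x\<in>B. scale (- g x) x)"
      by (subst sum.subset_diff[OF B'(1) finB']) (auto intro!: arg_cong2[of _ _ _ _ "(+)"] sum.cong)
    also have "\<dots> = 0" using g by (simp add: scale_minus_left sum_negf)
    finally have "(if x \<in> B then - g x else f x) = 0" if "x \<in> B'" for x
      using that
        independentD[OF B'(3) finB' order_refl, where u = "\<lambda>x. if x \<in> B then - g x else f x"]
      by simp
    then show ?thesis by (metis Diff_iff)
  qed
  show ?thesis
  proof (rule that)
    show "finite (B' - B)" "B' - B \<subseteq> V" using finB' B'(2) by auto
  qed (use dimV sp indep in blast)+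
qed

lemma (in vector_space) dim_psubset_subspace:
  assumes "subspace S" "subspace V" "S \<subset> V" "finite F" "V \<subseteq> span F"
  shows "dim S < dim V"
proof -
  obtain C where C: "finite C" "dim V = dim S + card C"
    "\<forall>z\<in>V. \<exists>s\<in>S. \<exists>f. z = s + (\<Sum>x\<in>C. scale (f x) x)"
    using complement_basis[OF assms(1,2) psubset_imp_subset[OF assms(3)] assms(4,5)] by metis
  have "C \<noteq> {}"
  proof
    assume "C = {}"
    then have "V \<subseteq> S" using C(3) by fastforce
    with assms(3) show False by blast
  qed
  then show ?thesis using C by (simp add: card_gt_0_iff)
qed

lemma linear_between_inv_into:
  assumes lin: "linear_between s V t W f" and bij: "bij_betw f V W"
    and add: "\<And>x y. x \<in> V \<Longrightarrow> y \<in> V \<Longrightarrow> x + y \<in> V"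
    and scale: "\<And>c x. x \<in> V \<Longrightarrow> s c x \<in> V"
  shows "linear_between t W s V (inv_into V f)"
proof -
  have inW: "inv_into V f y \<in> V" "f (inv_into V f y) = y" if "y \<in> W" for y
    using bij that by (auto simp: bij_betw_def inv_into_into f_inv_into_f)
  have inv: "inv_into V f (f x) = x" if "x \<in> V" for x
    using bij that by (simp add: bij_betw_def)
  have "inv_into V f (x + y) = inv_into V f x + inv_into V f y" if "x \<in> W" "y \<in> W" for x y
    using inv[OF add[OF inW(1) inW(1)], OF that] inW[OF that(1)] inW[OF that(2)] lin
    unfolding linear_between_def by auto
  moreover have "inv_into V f (t c x) = s c (inv_into V f x)" if "x \<in> W" for c x
    using inv[OF scale[OF inW(1)], OF that] inW[OF that] lin
    unfolding linear_between_def by auto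
  ultimately show ?thesis
    using inW by (auto simp: linear_between_def)
qed

section \<open>The support of a block\<close>

lemma mem_strip: "p \<in> strip c0 c1 \<longleftrightarrow> c0 \<le> fst p + snd p \<and> fst p + snd p \<le> c1"
  by (auto simp: strip_def split: prod.splits)

lemma mem_strip_interior: "p \<in> strip_interior c0 c1 \<longleftrightarrow> c0 < fst p + snd p \<and> fst p + snd p < c1"
  by (auto simp: strip_def strip_interior_def strip_boundary_def strip_line_def split: prod.splits)

lemma mem_strip_boundary: "p \<in> strip_boundary c0 c1 \<longleftrightarrow> fst p + snd p = c0 \<or> fst p + snd p = c1"
  by (auto simp: strip_boundary_def strip_line_def split: prod.splits)

text \<open>
  For an interior point \<open>v\<close> this is the half-open rectangle with upper left corner \<open>v\<close> whose
  lower left and upper right corners lie on the two boundary lines.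
\<close>

lemma mem_block_support:
  assumes "v \<in> strip c0 c1"
  shows "u \<in> block_support c0 c1 v \<longleftrightarrow>
    fst v \<le> fst u \<and> fst u < c1 - snd v \<and> c0 - fst v < snd u \<and> snd u \<le> snd v" (is "?L \<longleftrightarrow> ?R")
proof
  assume ?R
  define O1 where "O1 = {p :: real \<times> real. fst p < c1 - snd v \<and> c0 - fst v < snd p}"
  have "open O1"
    unfolding O1_def by (intro open_Collect_conj open_Collect_less continuous_intros)
  then have "openin (top_of_set (strip c0 c1)) (strip c0 c1 \<inter> O1)"
    by (rule openin_open_Int)
  moreover have "strip c0 c1 \<inter> O1 \<subseteq> strip_up c0 c1 (inv (strip_T c0 c1) v)"
    by (auto simp: O1_def strip_up_def inv_strip_T strip_le_def split: prod.splits)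
  moreover have "u \<in> strip c0 c1 \<inter> O1"
    using \<open>?R\<close> assms by (auto simp: O1_def mem_strip)
  ultimately show ?L
    using \<open>?R\<close> unfolding block_support_def interior_of_def strip_down_def strip_le_def by blast
next
  assume ?L
  then obtain O1 where O1: "openin (top_of_set (strip c0 c1)) O1" "u \<in> O1"
    "O1 \<subseteq> strip_up c0 c1 (inv (strip_T c0 c1) v)"
    by (auto simp: block_support_def interior_of_def)
  have u: "u \<in> strip c0 c1" "fst v \<le> fst u" "snd u \<le> snd v"
    using \<open>?L\<close> by (auto simp: block_support_def strip_down_def strip_le_def)
  obtain e where e: "e > 0" "ball u e \<inter> strip c0 c1 \<subseteq> O1"
    using O1(1,2) unfolding openin_contains_ball by meson
  \<comment> \<open>Moving along the antidiagonal stays in the strip and decreases the point in the order.\<close>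
  define u' where "u' = (fst u + e / 4, snd u - e / 4)"
  have "dist u u' \<le> dist (fst u) (fst u') + dist (snd u) (snd u')"
    unfolding dist_prod_def by (rule sqrt_sum_squares_le_sum) auto
  then have "dist u u' < e"
    using e(1) by (simp add: u'_def dist_real_def)
  moreover have "u' \<in> strip c0 c1"
    using u(1) by (simp add: u'_def mem_strip)
  ultimately have "u' \<in> strip_up c0 c1 (inv (strip_T c0 c1) v)"
    using e O1 by auto
  then show ?R
    using u e(1) by (auto simp: strip_up_def inv_strip_T strip_le_def u'_def split: prod.splits)
qed

section \<open>Images and kernels of the internal maps\<close>

locale cohomological_strip =
  fixes c0 c1 :: real and G :: "('k::field, 'v::ab_group_add) presheaf"
  assumes is_functor: "contravariant_functor c0 c1 G"
    and pfd: "pointwise_finite_dimensional c0 c1 G"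
    and coh: "cohomological c0 c1 G"
    and cont: "sequentially_continuous c0 c1 G"
begin

sublocale vector_space "scalar_mult G"
  using is_functor by (simp add: contravariant_functor_def)

abbreviation M where "M \<equiv> strip c0 c1"
abbreviation scl (infixr "*\<^sub>G" 75) where "scl \<equiv> scalar_mult G"
abbreviation r where "r \<equiv> imap G"

lemma obj_subspace: "u \<in> M \<Longrightarrow> subspace (obj G u)"
  using is_functor by (simp add: contravariant_functor_def)

lemma r_linear: "u \<in> M \<Longrightarrow> v \<in> M \<Longrightarrow> u \<preceq> v \<Longrightarrow> linear_between scl (obj G v) scl (obj G u) (r u v)"
  using is_functor by (simp add: contravariant_functor_def)

lemma
  assumes "u \<in> M" "v \<in> M" "u \<preceq> v" "z \<in> obj G v"
  shows r_mem: "r u v z \<in> obj G u"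
    and r_add: "\<And>z'. z' \<in> obj G v \<Longrightarrow> r u v (z + z') = r u v z + r u v z'"
    and r_scale: "r u v (a *\<^sub>G z) = a *\<^sub>G r u v z"
  using r_linear[OF assms(1-3)] assms(4) by (auto simp: linear_between_def)

lemma r_0: "u \<in> M \<Longrightarrow> v \<in> M \<Longrightarrow> u \<preceq> v \<Longrightarrow> r u v 0 = 0"
  using r_scale[of u v 0 0] obj_subspace[of v] by (simp add: subspace_0)

lemma r_diff:
  assumes "u \<in> M" "v \<in> M" "u \<preceq> v" "z \<in> obj G v" "z' \<in> obj G v"
  shows "r u v (z - z') = r u v z - r u v z'"
  using r_add[OF assms(1-4), of "- z'"] r_scale[OF assms(1-3,5), of "-1"] assms
    obj_subspace subspace_neg by (simp add: scale_minus_left)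

lemma r_sum:
  assumes "u \<in> M" "v \<in> M" "u \<preceq> v" "\<And>i. i \<in> A \<Longrightarrow> f i \<in> obj G v"
  shows "r u v (\<Sum>i\<in>A. f i) = (\<Sum>i\<in>A. r u v (f i))"
  using assms(4)
proof (induction A rule: infinite_finite_induct)
  case (insert x A)
  then have "(\<Sum>i\<in>A. f i) \<in> obj G v"
    using obj_subspace[OF assms(2)] by (intro subspace_sum) auto
  then show ?case using insert r_add[OF assms(1-3)] by simp
qed (use r_0 assms in auto)

lemma r_comp:
  "u \<in> M \<Longrightarrow> v \<in> M \<Longrightarrow> w \<in> M \<Longrightarrow> u \<preceq> v \<Longrightarrow> v \<preceq> w \<Longrightarrow> z \<in> obj G w \<Longrightarrow> r u v (r v w z) = r u w z"
  using is_functor by (simp add: contravariant_functor_def)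

lemma r_id: "u \<in> M \<Longrightarrow> z \<in> obj G u \<Longrightarrow> r u u z = z"
  using is_functor by (simp add: contravariant_functor_def)

lemma obj_boundary: "fst u + snd u = c0 \<or> fst u + snd u = c1 \<Longrightarrow> obj G u = {0}"
  using coh mem_strip_boundary[of u] by (simp add: cohomological_def)

lemma r_through_boundary:
  assumes "u \<in> M" "v \<in> M" "b \<in> M" "u \<preceq> b" "b \<preceq> v" "z \<in> obj G v"
    and "fst b + snd b = c0 \<or> fst b + snd b = c1"
  shows "r u v z = 0"
  using r_comp[of u b v z] r_mem[of b v z] obj_boundary[of b] r_0[of u b] assms by auto

text \<open>
  These are the two consecutive places in the long exact sequence on which the whole proof rests.
  The point \<open>(c0 - y, y')\<close> is \<open>T(x, y)\<close>, because \<open>(x, y')\<close> lies on the line \<open>l\<^sub>1\<close>.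
\<close>

lemma
  assumes "c0 \<le> x' + y" "x' \<le> x" "y \<le> y'" "x + y' = c1"
  shows vertical_image: "r (x', y) (x', y') ` obj G (x', y')
      = {z \<in> obj G (x', y). r (x, y) (x', y) z = 0}"
    and horizontal_image: "r (x', y') (c0 - y, y') ` obj G (c0 - y, y')
      = {z \<in> obj G (x', y'). r (x', y) (x', y') z = 0}"
proof -
  have "{x'..x} \<times> {y..y'} \<subseteq> M" using assms by (auto simp: strip_def)
  moreover have "(x, y') \<in> strip_line c1" using assms by (simp add: strip_line_def)
  ultimately have ex: "exact_at G (strip_T_iter c0 c1 0 (x, y)) (strip_T_iter c0 c1 0 (x', y)) (strip_T_iter c0 c1 0 (x', y'))"
    "exact_at G (strip_T_iter c0 c1 0 (x', y)) (strip_T_iter c0 c1 0 (x', y')) (strip_T_iter c0 c1 (0 + 1) (x, y))"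
    using conjunct2[OF coh[unfolded cohomological_def Let_def], rule_format, OF assms(2,3), of 0]
    by simp_all
  moreover have "c1 - x = y'" using assms by simp
  ultimately show "r (x', y) (x', y') ` obj G (x', y') = {z \<in> obj G (x', y). r (x, y) (x', y) z = 0}"
    "r (x', y') (c0 - y, y') ` obj G (c0 - y, y') = {z \<in> obj G (x', y'). r (x', y) (x', y') z = 0}"
    by (auto simp: exact_at_def strip_T_iter_def strip_T_def)
qed

text \<open>
  An image is turned into kernels in order to separate the coordinates \<open>x'\<close> and \<open>y'\<close>, and because
  kernels behave well along increasing sequences. A vector in both kernels is first lifted
  horizontally to \<open>(x', snd u)\<close>. The map from there to \<open>(c1 - y', snd u)\<close> passes through \<open>u\<close>, so
  the second kernel condition carries over to the lift, and it can be lifted vertically as well.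
\<close>

lemma image_iff_kernels:
  assumes u: "u \<in> M" and x': "c0 - snd u \<le> x'" "x' \<le> fst u"
    and y': "snd u \<le> y'" "y' \<le> c1 - fst u" and z: "z \<in> obj G u"
  shows "z \<in> r u (x', y') ` obj G (x', y') \<longleftrightarrow>
    r (fst u, c0 - x') u z = 0 \<and> r (c1 - y', snd u) u z = 0" (is "?L \<longleftrightarrow> ?X \<and> ?Y")
proof
  assume ?L
  then obtain p where p: "p \<in> obj G (x', y')" "z = r u (x', y') p" by blast
  have le: "u \<preceq> (x', y')" "(fst u, c0 - x') \<preceq> u" "(c1 - y', snd u) \<preceq> u"
    "(fst u, c0 - x') \<preceq> (x', c0 - x')" "(x', c0 - x') \<preceq> (x', y')"
    "(c1 - y', snd u) \<preceq> (c1 - y', y')" "(c1 - y', y') \<preceq> (x', y')"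
    and M: "(x', y') \<in> M" "(fst u, c0 - x') \<in> M" "(c1 - y', snd u) \<in> M"
     "(x', c0 - x') \<in> M" "(c1 - y', y') \<in> M"
    using u x' y' by (auto simp: strip_le_def mem_strip)
  have "r (fst u, c0 - x') (x', y') p = 0"
    using r_through_boundary[OF M(2,1,4) le(4,5) p(1)] by simp
  moreover have "r (c1 - y', snd u) (x', y') p = 0"
    using r_through_boundary[OF M(3,1,5) le(6,7) p(1)] by simp
  ultimately show "?X \<and> ?Y"
    using r_comp[OF M(2) u M(1) le(2,1) p(1)] r_comp[OF M(3) u M(1) le(3,1) p(1)] p(2) by simp
next
  assume XY: "?X \<and> ?Y"
  have le: "u \<preceq> (x', snd u)" "(x', snd u) \<preceq> (x', y')" "(c1 - y', snd u) \<preceq> u"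
    and M: "(x', y') \<in> M" "(x', snd u) \<in> M" "(c1 - y', snd u) \<in> M"
    using u x' y' by (auto simp: strip_le_def mem_strip)
  have "z \<in> r u (x', snd u) ` obj G (x', snd u)"
    using horizontal_image[of "fst u" "c0 - x'" "c1 - snd u" "snd u"] XY z x' u
    by (simp add: mem_strip)
  then obtain p where p: "p \<in> obj G (x', snd u)" "z = r u (x', snd u) p" by blast
  have "r (c1 - y', snd u) (x', snd u) p = 0"
    using r_comp[OF M(3) u M(2) le(3,1) p(1)] p(2) XY by simp
  then have "p \<in> r (x', snd u) (x', y') ` obj G (x', y')"
    using vertical_image[of x' "snd u" "c1 - y'" y'] p(1) x' y' by simp
  then obtain q where q: "q \<in> obj G (x', y')" "p = r (x', snd u) (x', y') q" by blast
  then show ?L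
    using r_comp[OF u M(2,1) le(1,2) q(1)] p(2) by auto
qed

text \<open>The radical of \<open>G\<close> at \<open>u\<close>: its codimension in \<open>G(u)\<close> is \<open>Dgm(G)(u)\<close>.\<close>

definition rad where "rad u = span (\<Union>v\<in>{v \<in> M. u \<prec> v}. r u v ` obj G v)"

lemma rad_subspace: "subspace (rad u)"
  by (simp add: rad_def)

lemma rad_mem: "v \<in> M \<Longrightarrow> u \<prec> v \<Longrightarrow> z \<in> obj G v \<Longrightarrow> r u v z \<in> rad u"
  unfolding rad_def by (rule span_base) blast

lemma rad_subset: "u \<in> M \<Longrightarrow> rad u \<subseteq> obj G u"
  unfolding rad_def by (rule span_minimal) (auto simp: obj_subspace strip_less_def intro!: r_mem)

text \<open>
  The map \<open>G(a, b) \<rightarrow> G(x, y)\<close> factors through \<open>G(x, b)\<close>. If \<open>z\<close> is in its kernel, then the image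
  of \<open>z\<close> in \<open>G(x, b)\<close> comes from \<open>(c0 - y, b)\<close>, which is strictly above \<open>(a, b)\<close> because \<open>(x, y)\<close>
  lies in the support. After subtracting the corresponding element of the radical, \<open>z\<close> is in the
  kernel of \<open>G(a, b) \<rightarrow> G(x, b)\<close>, and so it comes from \<open>(a, c1 - x)\<close>, also strictly above.
\<close>

lemma kernel_subset_rad:
  assumes v: "v \<in> M" and u: "u \<in> block_support c0 c1 v"
    and z: "z \<in> obj G v" "r u v z = 0"
  shows "z \<in> rad v"
proof -
  obtain x y where u_eq: "u = (x, y)" by fastforce
  obtain a b where v_eq: "v = (a, b)" by fastforce
  have ineq: "a \<le> x" "x < c1 - b" "c0 - a < y" "y \<le> b"
    using u mem_block_support[OF v] by (auto simp: u_eq v_eq)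
  have M: "(x, y) \<in> M" "(x, b) \<in> M" "(a, b) \<in> M" "(c0 - y, b) \<in> M" "(a, c1 - x) \<in> M"
    using ineq v by (auto simp: mem_strip v_eq)
  have le: "(x, y) \<preceq> (x, b)" "(x, b) \<preceq> (a, b)" "(a, b) \<preceq> (c0 - y, b)"
    using ineq by (auto simp: strip_le_def)
  have "r (x, y) (x, b) (r (x, b) (a, b) z) = 0"
    using r_comp[OF M(1-3) le(1,2)] z by (simp add: u_eq v_eq)
  then have "r (x, b) (a, b) z \<in> r (x, b) (c0 - y, b) ` obj G (c0 - y, b)"
    using horizontal_image[of x y "c1 - b" b] r_mem[OF M(2,3) le(2)] ineq z by (simp add: v_eq)
  then obtain t where t: "t \<in> obj G (c0 - y, b)" "r (x, b) (a, b) z = r (x, b) (c0 - y, b) t"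
    by blast
  let ?s = "r (a, b) (c0 - y, b) t"
  have s: "?s \<in> obj G (a, b)" "?s \<in> rad (a, b)"
    using r_mem[OF M(3,4) le(3) t(1)] rad_mem[OF M(4) _ t(1)] ineq
    by (auto simp: strip_less_def strip_le_def)
  have "r (x, b) (a, b) (z - ?s) = 0"
    using r_diff[OF M(2,3) le(2) _ s(1)] r_comp[OF M(2-4) le(2,3) t(1)] t z by (simp add: v_eq)
  moreover have "z - ?s \<in> obj G (a, b)"
    using z s obj_subspace[OF M(3)] by (simp add: v_eq subspace_diff)
  ultimately have "z - ?s \<in> r (a, b) (a, c1 - x) ` obj G (a, c1 - x)"
    using vertical_image[of a b x "c1 - x"] ineq by simp
  then have "z - ?s \<in> rad (a, b)"
    using rad_mem[OF M(5), of "(a, b)"] ineq by (auto simp: strip_less_def strip_le_def)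
  then have "(z - ?s) + ?s \<in> rad (a, b)"
    using s rad_subspace subspace_add by blast
  then show ?thesis by (simp add: v_eq)
qed

text \<open>
  Injectivity of the natural map to the inverse limit: the image of \<open>z\<close> in \<open>G(x)\<close> vanishes at
  every term of the sequence.
\<close>

lemma kernel_at_limit:
  assumes u: "u \<in> M" and x: "x \<in> M" "x \<preceq> u" and z: "z \<in> obj G u"
    and U: "\<And>k. U k \<in> M" "\<And>k. U k \<preceq> U (Suc k)" "\<And>k. U k \<preceq> x" "U \<longlonglongrightarrow> x"
    and zero: "\<And>k. r (U k) u z = 0"
  shows "r x u z = 0"
proof -
  have "inj_on (\<lambda>z k. r (U k) x z) (obj G x)"
    using cont[unfolded sequentially_continuous_def, rule_format, OF x(1) U(1,2,4)]
    by (simp add: bij_betw_def)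
  moreover have "(\<lambda>k. r (U k) x (r x u z)) = (\<lambda>k. r (U k) x 0)"
    using r_comp[OF U(1) x(1) u U(3) x(2) z] r_0[OF U(1) x(1) U(3)] zero by auto
  ultimately show ?thesis
    using r_mem[OF x(1) u x(2) z] obj_subspace[OF x(1)] subspace_0 by (auto dest: inj_onD)
qed

text \<open>
  Along an increasing path the parameters at which \<open>I\<close> is killed form an initial segment, and by
  continuity this segment is closed. The path will be either of the two families of points that
  occur in \<open>image_iff_kernels\<close>.
\<close>

lemma largest_zero_attained:
  fixes \<gamma> :: "real \<Rightarrow> real \<times> real"
  assumes u: "u \<in> M" and "s0 \<le> s1"
    and \<gamma>: "\<And>t. t \<in> {s0..s1} \<Longrightarrow> \<gamma> t \<in> M \<and> \<gamma> t \<preceq> u"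
    and mono: "\<And>s t. s0 \<le> s \<Longrightarrow> s \<le> t \<Longrightarrow> t \<le> s1 \<Longrightarrow> \<gamma> s \<preceq> \<gamma> t"
    and cont_\<gamma>: "continuous_on {s0..s1} \<gamma>"
    and I: "I \<subseteq> obj G u" and start: "\<And>z. z \<in> I \<Longrightarrow> r (\<gamma> s0) u z = 0"
  obtains t where "t \<in> {s0..s1}" "\<And>z. z \<in> I \<Longrightarrow> r (\<gamma> t) u z = 0"
    "\<And>t'. t < t' \<Longrightarrow> t' \<le> s1 \<Longrightarrow> \<exists>z\<in>I. r (\<gamma> t') u z \<noteq> 0"
proof -
  define A where "A = {t \<in> {s0..s1}. \<forall>z\<in>I. r (\<gamma> t) u z = 0}"
  have down: "s \<in> A" if "t \<in> A" "s0 \<le> s" "s \<le> t" for s t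
  proof -
    have st: "\<gamma> s \<in> M" "\<gamma> t \<in> M" "\<gamma> s \<preceq> \<gamma> t" "\<gamma> t \<preceq> u"
      using that \<gamma>[of s] \<gamma>[of t] mono[of s t] by (auto simp: A_def)
    have "r (\<gamma> s) u z = 0" if "z \<in> I" for z
      using r_comp[OF st(1,2) u st(3,4), of z] r_0[OF st(1-3)] that I \<open>t \<in> A\<close> by (auto simp: A_def)
    then show ?thesis using that by (auto simp: A_def)
  qed
  have s0: "s0 \<in> A" using start \<open>s0 \<le> s1\<close> by (simp add: A_def)
  have bdd: "bdd_above A" by (rule bdd_aboveI[of _ s1]) (simp add: A_def)
  define t where "t = Sup A"
  have t: "s0 \<le> t" "t \<le> s1"
    unfolding t_def
  proof (rule cSup_upper[OF s0 bdd])
    show "Sup A \<le> s1" by (rule cSup_least) (use s0 in \<open>auto simp: A_def\<close>)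
  qed
  define h where "h k = t - (t - s0) / real (Suc k)" for k
  have h_le: "s0 \<le> h k" "h k \<le> t" for k
  proof -
    have "(t - s0) / real (Suc k) \<le> (t - s0) / 1"
      using t by (intro divide_left_mono) auto
    moreover have "0 \<le> (t - s0) / real (Suc k)"
      using t by (intro divide_nonneg_nonneg) auto
    ultimately show "s0 \<le> h k" "h k \<le> t" by (auto simp: h_def)
  qed
  have h_A: "h k \<in> A" for k
  proof (cases "t = s0")
    case True
    then show ?thesis using s0 by (simp add: h_def)
  next
    case False
    then have "0 < (t - s0) / real (Suc k)" using t by (intro divide_pos_pos) auto
    then have "h k < Sup A" by (simp add: h_def t_def)
    then obtain a where "a \<in> A" "h k < a"
      using less_cSupE[of "h k" A] s0 by blast
    then show ?thesis using down h_le by (meson less_imp_le)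
  qed
  have h_mono: "h k \<le> h (Suc k)" for k
  proof -
    have "(t - s0) / real (Suc (Suc k)) \<le> (t - s0) / real (Suc k)"
      using t by (intro divide_left_mono) auto
    then show ?thesis unfolding h_def by linarith
  qed
  have "(\<lambda>k. t - (t - s0) * inverse (real (Suc k))) \<longlonglongrightarrow> t - (t - s0) * 0"
    by (intro tendsto_intros LIMSEQ_inverse_real_of_nat)
  then have "h \<longlonglongrightarrow> t" by (simp add: h_def[abs_def] divide_inverse)
  then have lim: "(\<lambda>k. \<gamma> (h k)) \<longlonglongrightarrow> \<gamma> t"
    by (rule continuous_on_tendsto_compose[OF cont_\<gamma>]) (use t h_A in \<open>auto simp: A_def\<close>)
  have "r (\<gamma> t) u z = 0" if "z \<in> I" for z
  proof (rule kernel_at_limit[where U = "\<lambda>k. \<gamma> (h k)"])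
    show "\<gamma> (h k) \<preceq> \<gamma> (h (Suc k))" for k
      by (rule mono[OF h_le(1) h_mono order_trans[OF h_le(2) t(2)]])
    show "\<gamma> (h k) \<preceq> \<gamma> t" for k
      by (rule mono[OF h_le t(2)])
    show "r (\<gamma> (h k)) u z = 0" for k
      using h_A that by (auto simp: A_def)
    show "\<gamma> (h k) \<in> M" for k
      using h_A \<gamma> by (auto simp: A_def)
  qed (use u \<gamma> t that I lim in auto)
  moreover have "\<exists>z\<in>I. r (\<gamma> t') u z \<noteq> 0" if "t < t'" "t' \<le> s1" for t'
  proof (rule ccontr)
    assume "\<not> ?thesis"
    then have "t' \<in> A" using that t by (auto simp: A_def)
    then show False using cSup_upper[OF _ bdd, of t'] that(1) by (simp add: t_def)
  qed
  ultimately show ?thesis using that t by auto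
qed

section \<open>Generators modulo the radical\<close>

abbreviation \<nu> where "\<nu> \<equiv> Dgm c0 c1 G"
abbreviation D where "D \<equiv> strip_interior c0 c1"

lemma interior_M: "v \<in> D \<Longrightarrow> v \<in> M"
  by (auto simp: strip_interior_def)

lemma obj_finite: "u \<in> M \<Longrightarrow> \<exists>F. finite F \<and> obj G u \<subseteq> span F"
  using pfd unfolding pointwise_finite_dimensional_def by blast

lemma generators_exist:
  assumes "v \<in> M"
  shows "\<exists>b. (\<forall>i<\<nu> v. b i \<in> obj G v) \<and>
    (\<forall>z\<in>obj G v. \<exists>s\<in>rad v. \<exists>f. z = s + (\<Sum>i<\<nu> v. f i *\<^sub>G b i)) \<and>
    (\<forall>f. (\<Sum>i<\<nu> v. f i *\<^sub>G b i) \<in> rad v \<longrightarrow> (\<forall>i<\<nu> v. f i = 0))"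
proof -
  obtain F where F: "finite F" "obj G v \<subseteq> span F"
    using obj_finite[OF assms] by blast
  obtain C where C: "finite C" "C \<subseteq> obj G v" "dim (obj G v) = dim (rad v) + card C"
    "\<forall>z\<in>obj G v. \<exists>s\<in>rad v. \<exists>f. z = s + (\<Sum>x\<in>C. f x *\<^sub>G x)"
    "\<forall>f. (\<Sum>x\<in>C. f x *\<^sub>G x) \<in> rad v \<longrightarrow> (\<forall>x\<in>C. f x = 0)"
    by (rule complement_basis[OF rad_subspace obj_subspace[OF assms] rad_subset[OF assms] F])
  have "\<nu> v = card C"
    using C(3) by (simp add: Dgm_def rad_def)
  then obtain b where b: "bij_betw b {..<\<nu> v} C"
    using C(1) by (metis card_lessThan finite_lessThan finite_same_card_bij)
  define b' where "b' = inv_into {..<\<nu> v} b"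
  have inv: "b' (b i) = i" if "i < \<nu> v" for i
    using b that by (simp add: b'_def bij_betw_def)
  have sum_C: "(\<Sum>x\<in>C. f x *\<^sub>G x) = (\<Sum>i<\<nu> v. f (b i) *\<^sub>G b i)" for f
    using sum.reindex_bij_betw[OF b, of "\<lambda>x. f x *\<^sub>G x"] by simp
  show ?thesis
  proof (intro exI[of _ b] conjI allI impI ballI)
    show "b i \<in> obj G v" if "i < \<nu> v" for i
      using b C(2) that by (auto simp: bij_betw_def)
    show "\<exists>s\<in>rad v. \<exists>f. z = s + (\<Sum>i<\<nu> v. f i *\<^sub>G b i)" if "z \<in> obj G v" for z
      using C(4)[rule_format, OF that] unfolding sum_C by metis
    show "f i = 0" if f: "(\<Sum>i<\<nu> v. f i *\<^sub>G b i) \<in> rad v" and i: "i < \<nu> v" for f i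
    proof -
      have "(\<Sum>x\<in>C. f (b' x) *\<^sub>G x) = (\<Sum>i<\<nu> v. f i *\<^sub>G b i)"
        unfolding sum_C by (rule sum.cong) (auto simp: inv)
      then have "\<forall>x\<in>C. f (b' x) = 0" using C(5)[rule_format, of "\<lambda>x. f (b' x)"] f by simp
      then show ?thesis using b i inv by (auto simp: bij_betw_def)
    qed
  qed
qed

text \<open>
  A basis of a complement of \<open>rad v\<close> in \<open>obj G v\<close>, numbered so that it fits the index set of
  \<open>direct_power\<close>.
\<close>

definition gen where
  "gen v = (SOME b. (\<forall>i<\<nu> v. b i \<in> obj G v) \<and>
    (\<forall>z\<in>obj G v. \<exists>s\<in>rad v. \<exists>f. z = s + (\<Sum>i<\<nu> v. f i *\<^sub>G b i)) \<and>
    (\<forall>f. (\<Sum>i<\<nu> v. f i *\<^sub>G b i) \<in> rad v \<longrightarrow> (\<forall>i<\<nu> v. f i = 0)))"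

text \<open>
  The coefficients are a finitely supported map, since this is what an element of the sum of
  blocks provides at \<open>v\<close>.
\<close>

definition \<beta> :: "real \<times> real \<Rightarrow> (nat \<Rightarrow>\<^sub>0 'k) \<Rightarrow> 'v" where
  "\<beta> v q = (\<Sum>i<\<nu> v. Poly_Mapping.lookup q i *\<^sub>G gen v i)"

lemma \<beta>_0: "\<beta> v 0 = 0"
  by (simp add: \<beta>_def)

lemma \<beta>_add: "\<beta> v (p + q) = \<beta> v p + \<beta> v q"
  by (simp add: \<beta>_def lookup_add scale_left_distrib sum.distrib)

lemma \<beta>_scale: "\<beta> v (Poly_Mapping.mapp (\<lambda>_. (*) c) q) = c *\<^sub>G \<beta> v q"
proof -
  have "Poly_Mapping.lookup (Poly_Mapping.mapp (\<lambda>_. (*) c) q) i = c * Poly_Mapping.lookup q i" for i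
    by (simp add: lookup_mapp when_def in_keys_iff)
  then show ?thesis by (simp add: \<beta>_def scale_sum_right)
qed

lemma
  assumes "v \<in> M"
  shows \<beta>_mem: "\<beta> v q \<in> obj G v"
    and \<beta>_spans: "z \<in> obj G v \<Longrightarrow>
      \<exists>s\<in>rad v. \<exists>q. Poly_Mapping.keys q \<subseteq> {..<\<nu> v} \<and> z = s + \<beta> v q"
    and \<beta>_independent: "\<beta> v q \<in> rad v \<Longrightarrow> Poly_Mapping.keys q \<subseteq> {..<\<nu> v} \<Longrightarrow> q = 0"
proof -
  note gen = someI_ex[OF generators_exist[OF assms], folded gen_def]
  show "\<beta> v q \<in> obj G v"
    unfolding \<beta>_def using gen obj_subspace[OF assms] by (intro subspace_sum subspace_scale) auto
  show "q = 0" if "\<beta> v q \<in> rad v" "Poly_Mapping.keys q \<subseteq> {..<\<nu> v}"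
  proof (rule poly_mapping_eqI)
    fix i
    have "\<forall>i<\<nu> v. Poly_Mapping.lookup q i = 0"
      using conjunct2[OF conjunct2[OF gen], rule_format, of "Poly_Mapping.lookup q"] that(1) by (simp add: \<beta>_def)
    then show "Poly_Mapping.lookup q i = Poly_Mapping.lookup 0 i"
      using that(2) by (cases "i < \<nu> v") (auto simp: in_keys_iff)
  qed
  show "\<exists>s\<in>rad v. \<exists>q. Poly_Mapping.keys q \<subseteq> {..<\<nu> v} \<and> z = s + \<beta> v q" if z: "z \<in> obj G v"
  proof -
    obtain s f where sf: "s \<in> rad v" "z = s + (\<Sum>i<\<nu> v. f i *\<^sub>G gen v i)"
      using gen z by blast
    define q where "q = Abs_poly_mapping (\<lambda>i. if i < \<nu> v then f i else 0)"
    have "finite {i. (if i < \<nu> v then f i else 0) \<noteq> 0}"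
      by (rule finite_subset[of _ "{..<\<nu> v}"]) auto
    then have q: "Poly_Mapping.lookup q i = (if i < \<nu> v then f i else 0)" for i
      by (simp add: q_def)
    then have "Poly_Mapping.keys q \<subseteq> {..<\<nu> v}"
      by (auto simp: in_keys_iff split: if_splits)
    moreover have "\<beta> v q = (\<Sum>i<\<nu> v. f i *\<^sub>G gen v i)"
      by (simp add: \<beta>_def q)
    ultimately show ?thesis
      by (intro bexI[OF _ sf(1)] exI[of _ q]) (simp add: sf(2))
  qed
qed

section \<open>The map from the sum of blocks\<close>

abbreviation DS where "DS \<equiv> direct_sum D (\<lambda>v. direct_power (block c0 c1 v :: ('k, 'k) presheaf) (\<nu> v))"

lemma DS_obj: "p \<in> obj DS u \<longleftrightarrow> (\<forall>v\<in>Poly_Mapping.keys p. v \<in> D \<and> u \<in> block_support c0 c1 v \<and>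
    Poly_Mapping.keys (Poly_Mapping.lookup p v) \<subseteq> {..<\<nu> v})"
proof -
  have "q \<in> obj (direct_power (block c0 c1 v :: ('k, 'k) presheaf) (\<nu> v)) u \<longleftrightarrow>
      q = 0 \<or> u \<in> block_support c0 c1 v \<and> Poly_Mapping.keys q \<subseteq> {..<\<nu> v}"
    for v and q :: "nat \<Rightarrow>\<^sub>0 'k"
  proof (cases "u \<in> block_support c0 c1 v")
    case True
    then show ?thesis by (auto simp: direct_power_def direct_sum_def block_def)
  next
    case False
    have "q = 0" if "Poly_Mapping.keys q \<subseteq> {..<\<nu> v}" "\<forall>i<\<nu> v. Poly_Mapping.lookup q i = 0"
      using that by (intro poly_mapping_eqI) (auto simp: in_keys_iff subset_iff)
    with False show ?thesis by (auto simp: direct_power_def direct_sum_def block_def)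
  qed
  then show ?thesis
    by (auto simp: direct_sum_def in_keys_iff)
qed

lemma DS_scale: "Poly_Mapping.lookup (scalar_mult DS c p) v =
    Poly_Mapping.mapp (\<lambda>_. (*) c) (Poly_Mapping.lookup p v)"
proof -
  have [simp]: "Poly_Mapping.mapp (\<lambda>_. (*) c) (0 :: nat \<Rightarrow>\<^sub>0 'k) = 0"
    by (rule poly_mapping_eqI) (simp add: lookup_mapp)
  show ?thesis
    by (simp add: direct_sum_def direct_power_def block_def lookup_mapp when_def in_keys_iff)
qed

lemma DS_imap: "Poly_Mapping.lookup (imap DS u w p) v =
    (if u \<in> block_support c0 c1 v \<and> w \<in> block_support c0 c1 v then Poly_Mapping.lookup p v else 0)"
  by (rule poly_mapping_eqI)
    (simp add: direct_sum_def direct_power_def block_def lookup_mapp when_def in_keys_iff)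

text \<open>
  The map that sends the unit of the \<open>i\<close>-th copy of \<open>B\<^sub>v\<close> at \<open>v\<close> to \<open>gen v i\<close>. For an element of
  \<open>obj DS u\<close> every key \<open>v\<close> has \<open>u\<close> in the support of its block, so that \<open>u \<preceq> v\<close>.
\<close>

definition \<Phi> where
  "\<Phi> u p = (\<Sum>v\<in>Poly_Mapping.keys p. r u v (\<beta> v (Poly_Mapping.lookup p v)))"

lemma support_le: "v \<in> D \<Longrightarrow> u \<in> block_support c0 c1 v \<Longrightarrow> u \<in> M \<and> v \<in> M \<and> u \<preceq> v"
  by (auto simp: block_support_def strip_down_def interior_M)

lemma \<Phi>_superset:
  assumes "finite A" "Poly_Mapping.keys p \<subseteq> A" "\<And>v. v \<in> A \<Longrightarrow> v \<in> D \<and> u \<in> block_support c0 c1 v"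
  shows "\<Phi> u p = (\<Sum>v\<in>A. r u v (\<beta> v (Poly_Mapping.lookup p v)))"
  unfolding \<Phi>_def
proof (rule sum.mono_neutral_left[OF assms(1,2)], rule ballI)
  fix v assume "v \<in> A - Poly_Mapping.keys p"
  then show "r u v (\<beta> v (Poly_Mapping.lookup p v)) = 0"
    using r_0[of u v] support_le[of v u] assms(3) by (auto simp: in_keys_iff \<beta>_0)
qed

lemma \<Phi>_mem: "u \<in> M \<Longrightarrow> p \<in> obj DS u \<Longrightarrow> \<Phi> u p \<in> obj G u"
  unfolding \<Phi>_def
  by (intro subspace_sum[OF obj_subspace] r_mem \<beta>_mem)
    (use support_le interior_M in \<open>simp_all add: DS_obj\<close>)

lemma DS_keys_bound:
  "p \<in> obj DS u \<Longrightarrow> Poly_Mapping.keys (Poly_Mapping.lookup p v) \<subseteq> {..<\<nu> v}"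
  by (cases "v \<in> Poly_Mapping.keys p") (auto simp: DS_obj not_in_keys_iff_lookup_eq_zero)

lemma DS_add:
  assumes p: "p \<in> obj DS u" and q: "q \<in> obj DS u"
  shows "p + q \<in> obj DS u"
  unfolding DS_obj
proof (intro ballI conjI)
  fix v assume "v \<in> Poly_Mapping.keys (p + q)"
  then have "v \<in> Poly_Mapping.keys p \<or> v \<in> Poly_Mapping.keys q"
    using subsetD[OF keys_add] by fast
  then show "v \<in> D" "u \<in> block_support c0 c1 v"
    using p q unfolding DS_obj by blast+
  show "Poly_Mapping.keys (Poly_Mapping.lookup (p + q) v) \<subseteq> {..<\<nu> v}"
    unfolding lookup_add using DS_keys_bound[OF p] DS_keys_bound[OF q] by (rule keys_add[THEN order_trans, OF Un_least])
qed

lemma DS_scale_keys: "Poly_Mapping.keys (scalar_mult DS c p) \<subseteq> Poly_Mapping.keys p"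
  by (simp add: direct_sum_def keys_mapp_subset)

lemma DS_scale_mem:
  assumes p: "p \<in> obj DS u"
  shows "scalar_mult DS c p \<in> obj DS u"
  unfolding DS_obj
proof (intro ballI conjI)
  fix v assume "v \<in> Poly_Mapping.keys (scalar_mult DS c p)"
  then have "v \<in> Poly_Mapping.keys p"
    by (rule subsetD[OF DS_scale_keys])
  then show "v \<in> D" "u \<in> block_support c0 c1 v"
    using p unfolding DS_obj by blast+
  show "Poly_Mapping.keys (Poly_Mapping.lookup (scalar_mult DS c p) v) \<subseteq> {..<\<nu> v}"
    unfolding DS_scale using keys_mapp_subset DS_keys_bound[OF p] by (rule order_trans)
qed

lemma \<Phi>_add:
  assumes p: "p \<in> obj DS u" and q: "q \<in> obj DS u"
  shows "\<Phi> u (p + q) = \<Phi> u p + \<Phi> u q"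
proof -
  let ?A = "Poly_Mapping.keys p \<union> Poly_Mapping.keys q"
  have A: "finite ?A" "\<And>v. v \<in> ?A \<Longrightarrow> v \<in> D \<and> u \<in> block_support c0 c1 v"
    using p q by (auto simp: DS_obj)
  have "r u v (\<beta> v (Poly_Mapping.lookup (p + q) v)) =
      r u v (\<beta> v (Poly_Mapping.lookup p v)) + r u v (\<beta> v (Poly_Mapping.lookup q v))" if "v \<in> ?A" for v
    using A(2)[OF that] support_le[of v u] r_add[of u v] \<beta>_mem by (simp add: lookup_add \<beta>_add)
  then show ?thesis
    using \<Phi>_superset[OF A(1) keys_add A(2)] \<Phi>_superset[OF A(1) _ A(2), of p]
      \<Phi>_superset[OF A(1) _ A(2), of q] by (simp add: sum.distrib[symmetric])
qed

lemma \<Phi>_scale: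
  assumes p: "p \<in> obj DS u"
  shows "\<Phi> u (scalar_mult DS c p) = c *\<^sub>G \<Phi> u p"
proof -
  let ?A = "Poly_Mapping.keys p"
  have A: "finite ?A" "\<And>v. v \<in> ?A \<Longrightarrow> v \<in> D \<and> u \<in> block_support c0 c1 v"
    using p by (auto simp: DS_obj)
  have "r u v (\<beta> v (Poly_Mapping.lookup (scalar_mult DS c p) v)) =
      c *\<^sub>G r u v (\<beta> v (Poly_Mapping.lookup p v))" if "v \<in> ?A" for v
    using A(2)[OF that] support_le[of v u] r_scale[of u v] \<beta>_mem by (simp add: DS_scale \<beta>_scale)
  then show ?thesis
    using \<Phi>_superset[OF A(1) DS_scale_keys A(2)] by (simp add: \<Phi>_def scale_sum_right)
qed

text \<open>
  A point below \<open>v\<close> outside the support is also below one of the two corners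
  \<open>(c1 - snd v, snd v)\<close> and \<open>(fst v, c0 - fst v)\<close>, which are below \<open>v\<close> and on the boundary. This
  makes \<open>\<Phi>\<close> natural: where a block vanishes, the images of its generators vanish too.
\<close>

lemma r_outside_support:
  assumes "u \<in> M" "v \<in> M" "u \<preceq> v" "u \<notin> block_support c0 c1 v" "z \<in> obj G v"
  shows "r u v z = 0"
proof -
  consider "c1 - snd v \<le> fst u" | "snd u \<le> c0 - fst v"
    using assms mem_block_support[OF assms(2), of u] by (force simp: strip_le_def)
  then show ?thesis
  proof cases
    case 1
    show ?thesis
      by (rule r_through_boundary[of u v "(c1 - snd v, snd v)"])
        (use 1 assms in \<open>auto simp: strip_le_def mem_strip\<close>)
  next
    case 2
    show ?thesis
      by (rule r_through_boundary[of u v "(fst v, c0 - fst v)"])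
        (use 2 assms in \<open>auto simp: strip_le_def mem_strip\<close>)
  qed
qed

lemma DS_imap_keys: "v \<in> Poly_Mapping.keys (imap DS u w p) \<longleftrightarrow>
    v \<in> Poly_Mapping.keys p \<and> u \<in> block_support c0 c1 v \<and> w \<in> block_support c0 c1 v"
  unfolding in_keys_iff DS_imap by simp

lemma DS_imap_mem: "p \<in> obj DS w \<Longrightarrow> imap DS u w p \<in> obj DS u"
  unfolding DS_obj by (intro ballI) (simp add: DS_imap_keys DS_imap)

lemma \<Phi>_natural:
  assumes u: "u \<in> M" "w \<in> M" "u \<preceq> w" and p: "p \<in> obj DS w"
  shows "\<Phi> u (imap DS u w p) = r u w (\<Phi> w p)"
proof -
  have v: "v \<in> D" "v \<in> M" "w \<in> block_support c0 c1 v" "w \<preceq> v" "u \<preceq> v"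
    if "v \<in> Poly_Mapping.keys p" for v
    using p that support_le[of v w] u(3) by (auto simp: DS_obj strip_le_def)
  have "r u w (\<Phi> w p) = (\<Sum>v\<in>Poly_Mapping.keys p. r u v (\<beta> v (Poly_Mapping.lookup p v)))"
    unfolding \<Phi>_def using u v r_mem \<beta>_mem r_comp by (subst r_sum) auto
  also have "\<dots> = (\<Sum>v\<in>Poly_Mapping.keys (imap DS u w p).
      r u v (\<beta> v (Poly_Mapping.lookup (imap DS u w p) v)))"
  proof (rule sum.mono_neutral_cong_right)
    show "Poly_Mapping.keys (imap DS u w p) \<subseteq> Poly_Mapping.keys p"
      using DS_imap_keys by blast
    show "\<forall>v\<in>Poly_Mapping.keys p - Poly_Mapping.keys (imap DS u w p).
        r u v (\<beta> v (Poly_Mapping.lookup p v)) = 0"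
    proof
      fix x assume x: "x \<in> Poly_Mapping.keys p - Poly_Mapping.keys (imap DS u w p)"
      then have "u \<notin> block_support c0 c1 x"
        using v(3)[of x] by (auto simp only: DS_imap_keys)
      then show "r u x (\<beta> x (Poly_Mapping.lookup p x)) = 0"
        using r_outside_support[OF u(1)] v(2,5)[of x] \<beta>_mem x by blast
    qed
    show "r u v (\<beta> v (Poly_Mapping.lookup p v)) = r u v (\<beta> v (Poly_Mapping.lookup (imap DS u w p) v))"
      if "v \<in> Poly_Mapping.keys (imap DS u w p)" for v
      using that by (simp add: DS_imap_keys DS_imap)
  qed auto
  finally show ?thesis by (simp add: \<Phi>_def)
qed

section \<open>Injectivity\<close>

text \<open>
  The keys of \<open>p\<close> are split into \<open>v0\<close>, the keys \<open>K2\<close> above \<open>v0\<close> with the same first coordinate, and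
  the keys \<open>K1\<close> with a smaller first coordinate. The summands of \<open>K2\<close> are absorbed into the
  radical at \<open>v0\<close>. Those of \<open>K1\<close> come from points with first coordinate at most \<open>x1 < x0\<close>, and by
  the relation their sum also comes from \<open>v0\<close>, hence from \<open>(x1, y0)\<close>, which is strictly above \<open>v0\<close>.
\<close>

lemma \<Phi>_injective:
  assumes u: "u \<in> M" and p: "p \<in> obj DS u" and zero: "\<Phi> u p = 0"
  shows "p = 0"
proof (rule ccontr)
  assume "p \<noteq> 0"
  define K where "K = Poly_Mapping.keys p"
  have K: "finite K" "K \<noteq> {}" using \<open>p \<noteq> 0\<close> by (simp_all add: K_def)
  have KM: "v \<in> M" "u \<preceq> v" "u \<in> block_support c0 c1 v"
    and Kineq: "fst v \<le> fst u" "fst u < c1 - snd v" "c0 - fst v < snd u" "snd u \<le> snd v"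
    if "v \<in> K" for v
    using p that support_le[of v u] mem_block_support[of v c0 c1 u] by (auto simp: K_def DS_obj)
  define z where "z v = \<beta> v (Poly_Mapping.lookup p v)" for v
  have z: "v \<in> K \<Longrightarrow> z v \<in> obj G v" for v
    by (simp add: z_def \<beta>_mem KM)
  define x0 where "x0 = Max (fst ` K)"
  define y0 where "y0 = Min (snd ` {v \<in> K. fst v = x0})"
  have "x0 \<in> fst ` K" using K by (simp add: x0_def)
  then have "y0 \<in> snd ` {v \<in> K. fst v = x0}"
    unfolding y0_def using K by (intro Min_in) auto
  then obtain v0 where v0: "v0 \<in> K" "v0 = (x0, y0)" by (auto simp: prod_eq_iff)
  have x0: "fst v \<le> x0" if "v \<in> K" for v
    using that K by (simp add: x0_def)
  have y0: "y0 \<le> snd v" if "v \<in> K" "fst v = x0" for v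
    using that K by (auto simp: y0_def intro!: Min_le)
  define K1 where "K1 = {v \<in> K. fst v < x0}"
  define K2 where "K2 = {v \<in> K. fst v = x0} - {v0}"
  have fin: "finite K1" "finite K2" using K by (auto simp: K1_def K2_def)
  have K_eq: "K = insert v0 (K1 \<union> K2)" "v0 \<notin> K1 \<union> K2" "K1 \<inter> K2 = {}"
    using v0 x0 by (auto simp: K1_def K2_def less_le)
  have \<Phi>_split: "\<Phi> u p = r u v0 (z v0) + ((\<Sum>v\<in>K1. r u v (z v)) + (\<Sum>v\<in>K2. r u v (z v)))"
    unfolding \<Phi>_def K_def[symmetric] z_def[symmetric] using fin K_eq(2,3)
    by (subst K_eq(1)) (simp add: sum.union_disjoint)
  define s2 where "s2 = (\<Sum>v\<in>K2. r v0 v (z v))"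
  have v0_M: "v0 \<in> M" "u \<preceq> v0" using KM v0(1) by auto
  have K2: "v \<in> M" "v0 \<prec> v" "v0 \<preceq> v" "z v \<in> obj G v" if "v \<in> K2" for v
  proof -
    have v: "v \<in> K" "fst v = x0" "v \<noteq> v0" using that by (auto simp: K2_def)
    show "v \<in> M" "z v \<in> obj G v" using KM z v by auto
    show "v0 \<preceq> v" "v0 \<prec> v" using y0[OF v(1,2)] v v0 by (auto simp: strip_le_def strip_less_def)
  qed
  have s2: "s2 \<in> obj G v0" "s2 \<in> rad v0"
    unfolding s2_def
    by (intro subspace_sum[OF obj_subspace] subspace_sum[OF rad_subspace] r_mem rad_mem v0_M K2; assumption)+
  have "r u v0 s2 = (\<Sum>v\<in>K2. r u v0 (r v0 v (z v)))"
    unfolding s2_def using K2 r_mem v0_M by (intro r_sum u) auto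
  also have "\<dots> = (\<Sum>v\<in>K2. r u v (z v))"
    using K2 r_comp u v0_M by (intro sum.cong) auto
  finally have r_s2: "r u v0 s2 = (\<Sum>v\<in>K2. r u v (z v))" .
  define t where "t = z v0 + s2"
  have t: "t \<in> obj G v0"
    unfolding t_def using s2 z v0 obj_subspace v0_M by (intro subspace_add) auto
  have sum0: "r u v0 t + (\<Sum>v\<in>K1. r u v (z v)) = 0"
    using zero \<Phi>_split r_add[OF u v0_M z[OF v0(1)] s2(1)] r_s2
    by (simp add: t_def algebra_simps)
  \<comment> \<open>The extra element is a lower bound of the admissible coordinates; it covers the case that
    \<open>K1\<close> is empty.\<close>
  define x1 where "x1 = Max (insert (c0 - snd u) (fst ` K1))"
  have x1: "c0 - snd u \<le> x1" "\<And>v. v \<in> K1 \<Longrightarrow> fst v \<le> x1"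
    using fin by (auto simp: x1_def)
  have x1_less: "x1 < x0"
    using fin Kineq[OF v0(1)] v0(2) by (auto simp: x1_def K1_def)
  have box: "x1 \<le> fst u" "snd u \<le> y0" "y0 \<le> c1 - fst u" "x0 \<le> fst u" "c0 - snd u \<le> x0"
    using Kineq[OF v0(1)] x1_less v0(2) by auto
  have ru: "r u v0 t \<in> obj G u" using r_mem u v0_M t by blast
  have q: "(fst u, c0 - x1) \<in> M" "(fst u, c0 - x1) \<preceq> u"
    using x1 box u by (auto simp: mem_strip strip_le_def)
  have K1_zero: "r (fst u, c0 - x1) u (r u v (z v)) = 0" if "v \<in> K1" for v
  proof -
    have vK: "v \<in> K" using that by (simp add: K1_def)
    have "r (fst u, c0 - x1) v (z v) = 0"
      by (rule r_through_boundary[of _ v "(fst v, c0 - fst v)"])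
        (use that x1 KM[OF vK] Kineq[OF vK] z[OF vK] q in \<open>auto simp: strip_le_def mem_strip\<close>)
    then show ?thesis using r_comp[OF q(1) u KM(1)[OF vK] q(2) KM(2)[OF vK] z[OF vK]] by simp
  qed
  have "r (fst u, c0 - x1) u (\<Sum>v\<in>K1. r u v (z v)) = (\<Sum>v\<in>K1. r (fst u, c0 - x1) u (r u v (z v)))"
    by (rule r_sum[OF q(1) u q(2)]) (use KM z r_mem u in \<open>auto simp: K1_def\<close>)
  also have "\<dots> = 0" using K1_zero by simp
  finally have K1_sum: "r (fst u, c0 - x1) u (\<Sum>v\<in>K1. r u v (z v)) = 0" .
  have "(\<Sum>v\<in>K1. r u v (z v)) \<in> obj G u"
    by (rule subspace_sum[OF obj_subspace[OF u]]) (use KM z r_mem u in \<open>auto simp: K1_def\<close>)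
  from r_add[OF q(1) u q(2) ru this] have "r (fst u, c0 - x1) u (r u v0 t) = 0"
    using K1_sum r_0[OF q(1) u q(2)] sum0 by simp
  moreover have "r (c1 - y0, snd u) u (r u v0 t) = 0"
    using image_iff_kernels[OF u box(5,4,2,3) ru] t v0(2) by blast
  ultimately have "r u v0 t \<in> r u (x1, y0) ` obj G (x1, y0)"
    using image_iff_kernels[OF u x1(1) box(1-3) ru] by simp
  then obtain q' where q': "q' \<in> obj G (x1, y0)" "r u v0 t = r u (x1, y0) q'" by blast
  have w: "(x1, y0) \<in> M" "v0 \<preceq> (x1, y0)" "v0 \<prec> (x1, y0)"
    using x1 box x1_less v0 v0_M by (auto simp: mem_strip strip_le_def strip_less_def)
  define s1 where "s1 = r v0 (x1, y0) q'"
  have s1: "s1 \<in> obj G v0" "s1 \<in> rad v0" "r u v0 s1 = r u v0 t"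
    unfolding s1_def using r_mem[OF v0_M(1) w(1,2) q'(1)] rad_mem[OF w(1,3) q'(1)]
      r_comp[OF u v0_M(1) w(1) v0_M(2) w(2) q'(1)] q'(2) by auto
  have "t - s1 \<in> rad v0"
    using kernel_subset_rad[OF v0_M(1) KM(3)[OF v0(1)], of "t - s1"] r_diff[OF u v0_M t s1(1)] s1(3) t s1(1)
      obj_subspace[OF v0_M(1)] by (simp add: subspace_diff)
  then have "(t - s1) + s1 - s2 \<in> rad v0"
    by (rule subspace_diff[OF rad_subspace subspace_add[OF rad_subspace _ s1(2)] s2(2)])
  then have "\<beta> v0 (Poly_Mapping.lookup p v0) \<in> rad v0"
    by (simp add: t_def z_def)
  then have "Poly_Mapping.lookup p v0 = 0"
    using \<beta>_independent[OF v0_M(1)] DS_keys_bound[OF p] by blast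
  then show False using v0 by (simp add: K_def in_keys_iff)
qed

section \<open>Surjectivity\<close>

lemma DS_0: "0 \<in> obj DS u"
  by (simp add: DS_obj)

lemma \<Phi>_image_subspace: "subspace (\<Phi> u ` obj DS u)"
proof (rule subspaceI)
  show "0 \<in> \<Phi> u ` obj DS u"
    using DS_0[of u] by (intro image_eqI[of _ _ 0]) (simp_all add: \<Phi>_def)
  show "x + y \<in> \<Phi> u ` obj DS u" if xy: "x \<in> \<Phi> u ` obj DS u" "y \<in> \<Phi> u ` obj DS u" for x y
  proof -
    obtain p q where "p \<in> obj DS u" "q \<in> obj DS u" "x = \<Phi> u p" "y = \<Phi> u q" using xy by blast
    then show ?thesis
      by (intro image_eqI[of _ _ "p + q"]) (simp_all only: \<Phi>_add DS_add)
  qed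
  show "c *\<^sub>G x \<in> \<Phi> u ` obj DS u" if x: "x \<in> \<Phi> u ` obj DS u" for c x
  proof -
    obtain p where "p \<in> obj DS u" "x = \<Phi> u p" using x by blast
    then show ?thesis
      by (intro image_eqI[of _ _ "scalar_mult DS c p"]) (simp_all only: \<Phi>_scale DS_scale_mem)
  qed
qed

lemma r_\<beta>_mem_image:
  assumes u: "u \<in> M" "u \<preceq> v" and v: "v \<in> D" and q: "Poly_Mapping.keys q \<subseteq> {..<\<nu> v}"
  shows "r u v (\<beta> v q) \<in> \<Phi> u ` obj DS u"
proof (cases "u \<in> block_support c0 c1 v")
  case True
  have "Poly_Mapping.single v q \<in> obj DS u"
    using True v q by (simp add: DS_obj)
  moreover have "\<Phi> u (Poly_Mapping.single v q) = r u v (\<beta> v q)"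
    using r_0[OF u(1) interior_M[OF v] u(2)] by (simp add: \<Phi>_def \<beta>_0)
  ultimately show ?thesis by (metis imageI)
next
  case False
  then have "r u v (\<beta> v q) = 0"
    using r_outside_support[OF u(1) interior_M[OF v] u(2)] \<beta>_mem[OF interior_M[OF v]] by blast
  then show ?thesis using \<Phi>_image_subspace subspace_0 by metis
qed

lemma image_step:
  assumes u: "u \<in> M" and v: "v \<in> M" "u \<preceq> v"
    and above: "\<And>w. w \<in> M \<Longrightarrow> v \<prec> w \<Longrightarrow> r u w ` obj G w \<subseteq> \<Phi> u ` obj DS u"
  shows "r u v ` obj G v \<subseteq> \<Phi> u ` obj DS u"
proof (cases "v \<in> D")
  case False
  then have "fst v + snd v = c0 \<or> fst v + snd v = c1"
    using v(1) by (auto simp: mem_strip mem_strip_interior)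
  then have "obj G v = {0}" by (rule obj_boundary)
  then show ?thesis
    using r_0[OF u v] \<Phi>_image_subspace[of u] subspace_0 by auto
next
  case True
  let ?E = "\<Phi> u ` obj DS u" and ?Z = "{z \<in> obj G v. r u v z \<in> \<Phi> u ` obj DS u}"
  have E: "subspace ?E" by (rule \<Phi>_image_subspace)
  have "subspace ?Z"
    using obj_subspace[OF v(1)] E r_0[OF u v] r_add[OF u v] r_scale[OF u v]
    by (intro subspaceI) (simp_all add: subspace_0 subspace_add subspace_scale)
  moreover have "r v w z \<in> ?Z" if w: "w \<in> M" "v \<prec> w" and z: "z \<in> obj G w" for w z
  proof -
    have "v \<preceq> w" using w(2) by (simp add: strip_less_def)
    then have "r u v (r v w z) \<in> r u w ` obj G w" "r v w z \<in> obj G v"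
      using r_comp[OF u v(1) w(1) v(2) _ z] r_mem[OF v(1) w(1) _ z] z by auto
    then show ?thesis using above[OF w] by blast
  qed
  ultimately have rad: "rad v \<subseteq> ?Z"
    unfolding rad_def by (intro span_minimal) blast+
  show ?thesis
  proof (rule image_subsetI)
    fix z assume "z \<in> obj G v"
    then obtain s q where sq: "s \<in> rad v" "Poly_Mapping.keys q \<subseteq> {..<\<nu> v}" "z = s + \<beta> v q"
      using \<beta>_spans[OF v(1)] by blast
    have "r u v z = r u v s + r u v (\<beta> v q)"
      using sq rad r_add[OF u v _ \<beta>_mem[OF v(1)], of s] by auto
    then show "r u v z \<in> ?E"
      using sq rad r_\<beta>_mem_image[OF u v(2) True sq(2)] subspace_add[OF E] by auto
  qed
qed

text \<open>
  The points between \<open>u\<close> and \<open>T(u)\<close> are parametrised as \<open>(c0 - s, c1 + t)\<close>, so that they move up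
  as \<open>s\<close> and \<open>t\<close> increase and each of the two kernel conditions involves only one parameter.
  The image in \<open>G(u)\<close> of \<open>G\<close> at a point above \<open>u\<close> outside this rectangle is zero.
\<close>

lemma \<Phi>_surjective:
  assumes u: "u \<in> M"
  shows "obj G u \<subseteq> \<Phi> u ` obj DS u"
proof (rule ccontr)
  assume contra: "\<not> ?thesis"
  let ?E = "\<Phi> u ` obj DS u"
  define J where "J s t = r u (c0 - s, c1 + t) ` obj G (c0 - s, c1 + t)" for s t
  define P where "P = (\<lambda>(s, t). s \<in> {c0 - fst u..snd u} \<and> t \<in> {snd u - c1..- fst u} \<and> \<not> J s t \<subseteq> ?E)"
  have box: "(c0 - s, c1 + t) \<in> M" "u \<preceq> (c0 - s, c1 + t)"
    if "s \<in> {c0 - fst u..snd u}" "t \<in> {snd u - c1..- fst u}" for s t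
    using that u by (auto simp: mem_strip strip_le_def)
  have J_iff: "z \<in> J s t \<longleftrightarrow> r (fst u, s) u z = 0 \<and> r (- t, snd u) u z = 0"
    if "s \<in> {c0 - fst u..snd u}" "t \<in> {snd u - c1..- fst u}" "z \<in> obj G u" for s t z
    using image_iff_kernels[OF u, of "c0 - s" "c1 + t" z] that by (simp add: J_def)
  have J_sub: "J s t \<subseteq> obj G u" "subspace (J s t)"
    if st: "s \<in> {c0 - fst u..snd u}" "t \<in> {snd u - c1..- fst u}" for s t
  proof -
    let ?v = "(c0 - s, c1 + t)"
    note bx = box[OF st] and sub = obj_subspace[OF box(1)[OF st]]
    show "J s t \<subseteq> obj G u" unfolding J_def using r_mem[OF u bx] by blast
    show "subspace (J s t)"
    proof (rule subspaceI)
      show "0 \<in> J s t" unfolding J_def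
        by (intro image_eqI[of _ _ 0]) (simp_all only: r_0[OF u bx] subspace_0[OF sub])
      show "x + y \<in> J s t" if xy: "x \<in> J s t" "y \<in> J s t" for x y
      proof -
        obtain a b where "a \<in> obj G ?v" "b \<in> obj G ?v" "x = r u ?v a" "y = r u ?v b"
          using xy by (auto simp: J_def)
        then show ?thesis unfolding J_def
          by (intro image_eqI[of _ _ "a + b"]) (simp_all only: r_add[OF u bx] subspace_add[OF sub])
      qed
      show "c *\<^sub>G x \<in> J s t" if x: "x \<in> J s t" for c x
      proof -
        obtain a where "a \<in> obj G ?v" "x = r u ?v a" using x by (auto simp: J_def)
        then show ?thesis unfolding J_def
          by (intro image_eqI[of _ _ "c *\<^sub>G a"]) (simp_all only: r_scale[OF u bx] subspace_scale[OF sub])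
      qed
    qed
  qed
  have "J (c0 - fst u) (snd u - c1) = obj G u"
    using r_id[OF u] by (simp add: J_def)
  then have "P (c0 - fst u, snd u - c1)"
    using contra u by (simp add: P_def mem_strip)
  from ex_has_least_nat[of P, OF this, of "\<lambda>(s, t). dim (J s t)"]
  obtain s0 t0 where least: "P (s0, t0)" "\<And>s t. P (s, t) \<Longrightarrow> dim (J s0 t0) \<le> dim (J s t)"
    by auto
  have s0: "s0 \<in> {c0 - fst u..snd u}" "t0 \<in> {snd u - c1..- fst u}" "\<not> J s0 t0 \<subseteq> ?E"
    using least(1) by (auto simp: P_def)
  let ?I = "J s0 t0"
  have I: "?I \<subseteq> obj G u" by (rule J_sub(1)[OF s0(1,2)])
  have I0: "r (fst u, s0) u z = 0" "r (- t0, snd u) u z = 0" if "z \<in> ?I" for z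
    using J_iff[OF s0(1,2), of z] that I by auto
  \<comment> \<open>Move the point up as far as \<open>?I\<close> still comes from it, separately in each coordinate.\<close>
  obtain s where s: "s \<in> {s0..snd u}" "\<And>z. z \<in> ?I \<Longrightarrow> r (fst u, s) u z = 0"
    "\<And>s'. s < s' \<Longrightarrow> s' \<le> snd u \<Longrightarrow> \<exists>z\<in>?I. r (fst u, s') u z \<noteq> 0"
  proof (rule largest_zero_attained[of u s0 "snd u" "\<lambda>s. (fst u, s)" ?I])
    show "(fst u, s) \<in> M \<and> (fst u, s) \<preceq> u" if "s \<in> {s0..snd u}" for s
      using u s0 that by (auto simp: mem_strip strip_le_def)
    show "continuous_on {s0..snd u} (\<lambda>s. (fst u, s))" by (intro continuous_intros)
  qed (use u s0 I I0 in \<open>auto simp: strip_le_def\<close>)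
  obtain t where t: "t \<in> {t0..- fst u}" "\<And>z. z \<in> ?I \<Longrightarrow> r (- t, snd u) u z = 0"
    "\<And>t'. t < t' \<Longrightarrow> t' \<le> - fst u \<Longrightarrow> \<exists>z\<in>?I. r (- t', snd u) u z \<noteq> 0"
  proof (rule largest_zero_attained[of u t0 "- fst u" "\<lambda>t. (- t, snd u)" ?I])
    show "(- t, snd u) \<in> M \<and> (- t, snd u) \<preceq> u" if "t \<in> {t0..- fst u}" for t
      using u s0 that by (auto simp: mem_strip strip_le_def)
    show "continuous_on {t0..- fst u} (\<lambda>t. (- t, snd u))" by (intro continuous_intros)
  qed (use u s0 I I0 in \<open>auto simp: strip_le_def\<close>)
  have st: "s \<in> {c0 - fst u..snd u}" "t \<in> {snd u - c1..- fst u}"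
    using s t s0 by auto
  have I_J: "?I \<subseteq> J s t"
    using J_iff[OF st] s(2) t(2) I by blast
  have "J s t \<subseteq> ?E"
    unfolding J_def
  proof (rule image_step[OF u box[OF st]])
    fix w assume w: "w \<in> M" "(c0 - s, c1 + t) \<prec> w"
    define s' t' where "s' = c0 - fst w" and "t' = snd w - c1"
    have w_eq: "w = (c0 - s', c1 + t')" by (simp add: s'_def t'_def)
    have le: "s \<le> s'" "t \<le> t'" and ne: "s < s' \<or> t < t'" and uw: "u \<preceq> w"
      using w(2) box(2)[OF st] by (auto simp: w_eq strip_less_def strip_le_def)
    show "r u w ` obj G w \<subseteq> ?E"
    proof (cases "s' \<le> snd u \<and> t' \<le> - fst u")
      case True
      then have st': "s' \<in> {c0 - fst u..snd u}" "t' \<in> {snd u - c1..- fst u}"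
        using le st by auto
      have v0: "(c0 - s0, c1 + t0) \<preceq> w"
        using le s t by (auto simp: w_eq strip_le_def)
      have "J s' t' \<subseteq> ?I"
        unfolding J_def w_eq[symmetric]
        using r_comp[OF u box(1)[OF s0(1,2)] w(1) box(2)[OF s0(1,2)] v0]
          r_mem[OF box(1)[OF s0(1,2)] w(1) v0] by (metis image_eqI image_subsetI)
      moreover have "J s' t' \<noteq> ?I"
      proof
        assume eq: "J s' t' = ?I"
        then have "r (fst u, s') u z = 0 \<and> r (- t', snd u) u z = 0" if "z \<in> ?I" for z
          using J_iff[OF st', of z] that I by blast
        then show False using ne s(3)[of s'] t(3)[of t'] True by blast
      qed
      ultimately have "J s' t' \<subset> ?I" by blast
      moreover obtain F where "finite F" "?I \<subseteq> span F"
        using obj_finite[OF u] I by blast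
      ultimately have "dim (J s' t') < dim ?I"
        using dim_psubset_subspace[OF J_sub(2)[OF st'] J_sub(2)[OF s0(1,2)]] by blast
      then have "\<not> P (s', t')" using least(2)[of s' t'] by linarith
      then show ?thesis using st' by (simp add: P_def J_def w_eq)
    next
      case False
      have "r u w z = 0" if z: "z \<in> obj G w" for z
      proof (cases "s' \<le> snd u")
        case True
        show ?thesis
          by (rule r_through_boundary[of u w "(fst u, c1 - fst u)"])
            (use False True u uw w z in \<open>auto simp: strip_le_def mem_strip t'_def\<close>)
      next
        case False
        show ?thesis
          by (rule r_through_boundary[of u w "(c0 - snd u, snd u)"])
            (use False u uw w z in \<open>auto simp: strip_le_def mem_strip s'_def\<close>)
      qed
      then show ?thesis using subspace_0[OF \<Phi>_image_subspace[of u]] by auto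
    qed
  qed
  with I_J s0(3) show False by blast
qed

section \<open>The decomposition\<close>

lemma \<Phi>_bij:
  assumes u: "u \<in> M"
  shows "bij_betw (\<Phi> u) (obj DS u) (obj G u)"
  unfolding bij_betw_def
proof
  show "\<Phi> u ` obj DS u = obj G u"
    using \<Phi>_surjective[OF u] \<Phi>_mem[OF u] by blast
  show "inj_on (\<Phi> u) (obj DS u)"
  proof (rule inj_onI)
    fix p q assume pq: "p \<in> obj DS u" "q \<in> obj DS u" "\<Phi> u p = \<Phi> u q"
    define q' where "q' = scalar_mult DS (- 1) q"
    have q': "q' \<in> obj DS u" unfolding q'_def by (rule DS_scale_mem[OF pq(2)])
    have "\<Phi> u (p + q') = \<Phi> u p + (- 1) *\<^sub>G \<Phi> u q"
      unfolding \<Phi>_add[OF pq(1) q'] unfolding q'_def \<Phi>_scale[OF pq(2)] ..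
    then have "\<Phi> u (p + q') = 0" using pq(3) by (simp add: scale_minus_left)
    then have sum0: "p + q' = 0" using \<Phi>_injective[OF u DS_add[OF pq(1) q']] by blast
    have "q' = - q"
      by (intro poly_mapping_eqI) (simp add: q'_def DS_scale lookup_mapp when_def in_keys_iff)
    with sum0 show "p = q" by simp
  qed
qed

lemma \<Phi>_linear: "u \<in> M \<Longrightarrow> linear_between (scalar_mult DS) (obj DS u) scl (obj G u) (\<Phi> u)"
  unfolding linear_between_def using \<Phi>_mem \<Phi>_add \<Phi>_scale by blast

theorem naturally_isomorphic_DS: "naturally_isomorphic c0 c1 G DS"
  unfolding naturally_isomorphic_def
proof (intro exI[of _ "\<lambda>u. inv_into (obj DS u) (\<Phi> u)"] conjI ballI impI)
  fix u assume u: "u \<in> M"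
  show "linear_between scl (obj G u) (scalar_mult DS) (obj DS u) (inv_into (obj DS u) (\<Phi> u))"
    using \<Phi>_linear[OF u] \<Phi>_bij[OF u] DS_add DS_scale_mem by (rule linear_between_inv_into)
  show "bij_betw (inv_into (obj DS u) (\<Phi> u)) (obj G u) (obj DS u)"
    using \<Phi>_bij[OF u] by (rule bij_betw_inv_into)
next
  fix u v x assume u: "u \<in> M" "v \<in> M" "u \<preceq> v" and x: "x \<in> obj G v"
  define p where "p = inv_into (obj DS v) (\<Phi> v) x"
  have p: "p \<in> obj DS v" "\<Phi> v p = x"
    using \<Phi>_bij[OF u(2)] x by (auto simp: p_def bij_betw_def inv_into_into f_inv_into_f)
  have "inv_into (obj DS u) (\<Phi> u) (\<Phi> u (imap DS u v p)) = imap DS u v p"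
    using \<Phi>_bij[OF u(1)] DS_imap_mem[OF p(1)] by (simp add: bij_betw_def)
  then show "inv_into (obj DS u) (\<Phi> u) (r u v x) = imap DS u v (inv_into (obj DS v) (\<Phi> v) x)"
    using \<Phi>_natural[OF u p(1)] p by (simp add: p_def)
qed

end

theorem theorem3p5:
  fixes c0 c1 :: real
    and G :: "('k::field, 'v::ab_group_add) presheaf"
    and \<nu> :: "real \<times> real \<Rightarrow> nat"
  assumes "c0 < c1"
    and "contravariant_functor c0 c1 G"
    and "pointwise_finite_dimensional c0 c1 G"
    and "cohomological c0 c1 G"
    and "sequentially_continuous c0 c1 G"
    and "\<nu> = Dgm c0 c1 G"
  shows "naturally_isomorphic c0 c1 G
           (direct_sum (strip_interior c0 c1) (\<lambda>v. direct_power (block c0 c1 v) (\<nu> v)))"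
proof -
  interpret cohomological_strip c0 c1 G
    using assms by unfold_locales
  show ?thesis
    unfolding \<open>\<nu> = Dgm c0 c1 G\<close> by (rule naturally_isomorphic_DS)
qed

end
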